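(* Let $M$ be a semigroup (or a monoid) that admits a semigroup presentation $(S,R)$ (as a semigroup, respectively as a monoid) satisfying the following conditions: (i) $R$ contains no relation $sv = sv'$ with $s\in S$, $v,v'\in S^*$ and $v\neq v'$; (ii) there exists a map $\lambda : M\to\mathbb{N}$ satisfying $\lambda(xy)\ge\lambda(x)+\lambda(y)$ for all $x,y\in M$ and $\lambda(s)\ge 1$ for (the class of) each $s\in S$; (iii) the right cube condition holds for each triple $(s,s',s'')\in S^3$. Then $M$ admits left-cancellation, i.e. for all $x,y,z\in M$, $xy=xz$ implies $y=z$.
   Context: A semigroup presentation $(S,R)$ consists of a nonempty set $S$ and a family $R$ of relations; a relation is an unordered pair $\{v,v'\}$ of nonempty words of $S^*$ (the free monoid on $S$), written $v=v'$. The presented monoid is $S^*/{\equiv}$, where $\equiv$ is the least congruence on $S^*$ containing $R$. $\varepsilon$ denotes the empty word. A signed word is a word in the alphabet $S\cup S^{-1}$, where $S^{-1}$ is a disjoint formal copy of $S$. For $w=s_1\cdots s_p\in S^*$, $w^{-1}$ denotes the signed word $s_p^{-1}\cdots s_1^{-1}$. Right-reversing: a signed word $\mathbf{w}$ right-reverses in one step to $\mathbf{w}'$ if $\mathbf{w}'$ is obtained from $\mathbf{w}$ by replacing some subword $s^{-1}s'$ (with $s,s'\in S$) by $v'v^{-1}$, where $v,v'\in S^*$ and $sv'=s'v$ is a relation of $R$, or by deleting some subword $s^{-1}s$ (i.e. the trivial relations $s=s$ are implicitly included in $R$). The relation $\curvearrowright_R$ is the reflexive-transitive closure of one-step right-reversing.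 Right cube condition for $(u,u',u'')$, where $u,u',u''\in S^*$: for all $v,v'\in S^*$, if $u^{-1}u''u''^{-1}u'\curvearrowright_R v'v^{-1}$, then $(uv')^{-1}(u'v)\curvearrowright_R\varepsilon$. *)

theory Defs
  imports "HOL-Algebra.Group" "HOL-Library.Uprod"
begin

definition is_semigroup :: "('m, 'k) monoid_scheme \<Rightarrow> bool" where
  (* the unit field of the record is deliberately unconstrained *)
  "is_semigroup M \<longleftrightarrow>
     (\<forall>x\<in>carrier M. \<forall>y\<in>carrier M. x \<otimes>\<^bsub>M\<^esub> y \<in> carrier M) \<and>
     (\<forall>x\<in>carrier M. \<forall>y\<in>carrier M. \<forall>z\<in>carrier M.
        (x \<otimes>\<^bsub>M\<^esub> y) \<otimes>\<^bsub>M\<^esub> z = x \<otimes>\<^bsub>M\<^esub> (y \<otimes>\<^bsub>M\<^esub> z))"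

definition semigroup_presentation :: "'s set \<Rightarrow> 's list uprod set \<Rightarrow> bool" where
  "semigroup_presentation S R \<longleftrightarrow>
     S \<noteq> {} \<and> (\<forall>v v'. Upair v v' \<in> R \<longrightarrow> v \<in> lists S - {[]} \<and> v' \<in> lists S - {[]})"

inductive_set word_cong :: "'s set \<Rightarrow> 's list uprod set \<Rightarrow> 's list rel"
  for S :: "'s set" and R :: "'s list uprod set" where
  rel: "Upair v v' \<in> R \<Longrightarrow> (v, v') \<in> word_cong S R"
| refl: "w \<in> lists S \<Longrightarrow> (w, w) \<in> word_cong S R"
| sym: "(v, w) \<in> word_cong S R \<Longrightarrow> (w, v) \<in> word_cong S R"
| trans: "(u, v) \<in> word_cong S R \<Longrightarrow> (v, w) \<in> word_cong S R \<Longrightarrow> (u, w) \<in> word_cong S R"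
| mult: "(u, u') \<in> word_cong S R \<Longrightarrow> (v, v') \<in> word_cong S R \<Longrightarrow> (u @ v, u' @ v') \<in> word_cong S R"

definition word_class :: "'s set \<Rightarrow> 's list uprod set \<Rightarrow> 's list \<Rightarrow> 's list set" where
  "word_class S R w = word_cong S R `` {w}"

definition presented_monoid :: "'s set \<Rightarrow> 's list uprod set \<Rightarrow> 's list set monoid" where
  "presented_monoid S R =
     \<lparr>carrier = lists S // word_cong S R,
      mult = (\<lambda>A B. \<Union>a\<in>A. \<Union>b\<in>B. word_class S R (a @ b)),
      one = word_class S R []\<rparr>"

(* The classes of the nonempty words. The inherited unit field lies outside
   the carrier and is never used. *)
definition presented_semigroup :: "'s set \<Rightarrow> 's list uprod set \<Rightarrow> 's list set monoid" where
  "presented_semigroup S R =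
     (presented_monoid S R)\<lparr>carrier := (lists S - {[]}) // word_cong S R\<rparr>"

(* Signed words: Inl s is the letter s, Inr s its formal inverse. *)
type_synonym 's signed_word = "('s + 's) list"

definition pos_word :: "'s list \<Rightarrow> 's signed_word" where
  "pos_word w = map Inl w"

definition inv_word :: "'s list \<Rightarrow> 's signed_word" where
  "inv_word w = rev (map Inr w)"

inductive right_reverses_step ::
  "'s set \<Rightarrow> 's list uprod set \<Rightarrow> 's signed_word \<Rightarrow> 's signed_word \<Rightarrow> bool"
  for S :: "'s set" and R :: "'s list uprod set" where
  relation: "s \<in> S \<Longrightarrow> s' \<in> S \<Longrightarrow> v \<in> lists S \<Longrightarrow> v' \<in> lists S \<Longrightarrow> Upair (s # v') (s' # v) \<in> R \<Longrightarrow>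
     right_reverses_step S R (x @ [Inr s, Inl s'] @ y) (x @ pos_word v' @ inv_word v @ y)"
| delete: "s \<in> S \<Longrightarrow>
     right_reverses_step S R (x @ [Inr s, Inl s] @ y) (x @ y)"

definition right_reverses ::
  "'s set \<Rightarrow> 's list uprod set \<Rightarrow> 's signed_word \<Rightarrow> 's signed_word \<Rightarrow> bool" where
  "right_reverses S R = (right_reverses_step S R)\<^sup>*\<^sup>*"

definition right_cube_condition ::
  "'s set \<Rightarrow> 's list uprod set \<Rightarrow> 's list \<Rightarrow> 's list \<Rightarrow> 's list \<Rightarrow> bool" where
  "right_cube_condition S R u u' u'' \<longleftrightarrow>
     (\<forall>v\<in>lists S. \<forall>v'\<in>lists S.
        right_reverses S R (inv_word u @ pos_word u'' @ inv_word u'' @ pos_word u')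
          (pos_word v' @ inv_word v) \<longrightarrow>
        right_reverses S R (inv_word (u @ v') @ pos_word (u' @ v)) [])"

end

theory Submission
  imports Defs
begin

text \<open>
  Call two words \<open>u\<close>, \<open>v\<close> reversing-equivalent if \<open>u\<^sup>-\<^sup>1 v\<close> right-reverses to the empty word.
  The point is that this relation is transitive, hence coincides with the congruence generated
  by \<open>R\<close>; condition (i) then allows one to read off left-cancellation of a letter from the
  first reversing step.  Transitivity is proved by induction on the weight of the words: for
  \<open>s u\<close>, \<open>t w\<close>, \<open>s' v\<close> equivalent in succession, the first reversing steps give relations
  \<open>s x = t y\<close> and \<open>t y' = s' x'\<close>, the induction hypothesis applied below \<open>t\<close> makes
  \<open>y\<^sup>-\<^sup>1 y'\<close> reverse to some \<open>c d\<^sup>-\<^sup>1\<close>, and the cube condition for \<open>(s, s', t)\<close> makes \<open>s x c\<close> and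
  \<open>s' x' d\<close> equivalent.  What is left is transitivity between words with the same first letter,
  which again only involves smaller words.
\<close>

declare in_listsD [rule del] in_listsI [rule del]

section \<open>Reversing grids\<close>

text \<open>\<open>reversing_grid S R u v v' u'\<close> means that the signed word \<open>u\<^sup>-\<^sup>1 v\<close> right-reverses to
  \<open>v' u'\<^sup>-\<^sup>1\<close>; in the rectangular diagram, \<open>u\<close> and \<open>v\<close> label the left and top sides, \<open>v'\<close> and
  \<open>u'\<close> the bottom and right sides.\<close>

inductive reversing_grid ::
  "'s set \<Rightarrow> 's list uprod set \<Rightarrow> 's list \<Rightarrow> 's list \<Rightarrow> 's list \<Rightarrow> 's list \<Rightarrow> bool"
  for S :: "'s set" and R :: "'s list uprod set" where
  tile: "\<lbrakk>s \<in> S; t \<in> S; x \<in> lists S; y \<in> lists S; Upair (s # x) (t # y) \<in> R\<rbrakk>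
     \<Longrightarrow> reversing_grid S R [s] [t] x y"
| same: "s \<in> S \<Longrightarrow> reversing_grid S R [s] [s] [] []"
| top: "v \<in> lists S \<Longrightarrow> reversing_grid S R [] v v []"
| left: "u \<in> lists S \<Longrightarrow> reversing_grid S R u [] [] u"
| hcomp: "\<lbrakk>reversing_grid S R u v\<^sub>1 w\<^sub>1 u\<^sub>1; reversing_grid S R u\<^sub>1 v\<^sub>2 w\<^sub>2 u\<^sub>2\<rbrakk>
     \<Longrightarrow> reversing_grid S R u (v\<^sub>1 @ v\<^sub>2) (w\<^sub>1 @ w\<^sub>2) u\<^sub>2"
| vcomp: "\<lbrakk>reversing_grid S R u\<^sub>1 v w\<^sub>1 t\<^sub>1; reversing_grid S R u\<^sub>2 w\<^sub>1 w\<^sub>2 t\<^sub>2\<rbrakk>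
     \<Longrightarrow> reversing_grid S R (u\<^sub>1 @ u\<^sub>2) v w\<^sub>2 (t\<^sub>1 @ t\<^sub>2)"

lemma reversing_grid_lists:
  "reversing_grid S R u v w t \<Longrightarrow> u \<in> lists S \<and> v \<in> lists S \<and> w \<in> lists S \<and> t \<in> lists S"
  by (induction rule: reversing_grid.induct) auto

text \<open>Reflection of the diagram in its diagonal swaps \<open>hcomp\<close> with
  \<open>vcomp\<close> and \<open>top\<close> with \<open>left\<close>; a tile stays a tile because
  relations are unordered pairs.\<close>

lemma reversing_grid_sym:
  "reversing_grid S R u v w t \<Longrightarrow> reversing_grid S R v u t w"
proof (induction rule: reversing_grid.induct)
  case (tile s t x y)
  moreover have "Upair (s # x) (t # y) = Upair (t # y) (s # x)" by (simp add: Upair_inject)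
  ultimately show ?case by (auto intro: reversing_grid.tile)
next
  case (hcomp u v\<^sub>1 w\<^sub>1 u\<^sub>1 v\<^sub>2 w\<^sub>2 u\<^sub>2)
  from hcomp.IH show ?case by (rule reversing_grid.vcomp)
next
  case (vcomp u\<^sub>1 v w\<^sub>1 t\<^sub>1 u\<^sub>2 w\<^sub>2 t\<^sub>2)
  from vcomp.IH show ?case by (rule reversing_grid.hcomp)
qed (auto intro: reversing_grid.same reversing_grid.top reversing_grid.left)

lemma reversing_grid_split_trivial:
  assumes "reversing_grid S R u v w t" "v = v\<^sub>1 @ v\<^sub>2" "v\<^sub>1 = [] \<or> v\<^sub>2 = []"
  shows "\<exists>u\<^sub>1 w\<^sub>1 w\<^sub>2. reversing_grid S R u v\<^sub>1 w\<^sub>1 u\<^sub>1 \<and> reversing_grid S R u\<^sub>1 v\<^sub>2 w\<^sub>2 t \<and> w = w\<^sub>1 @ w\<^sub>2"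
  using assms(3)
proof
  assume "v\<^sub>1 = []"
  then show ?thesis using assms reversing_grid_lists[OF assms(1)]
    by (intro exI[of _ u] exI[of _ "[]"] exI[of _ w]) (auto intro: reversing_grid.left)
next
  assume "v\<^sub>2 = []"
  then show ?thesis using assms reversing_grid_lists[OF assms(1)]
    by (intro exI[of _ t] exI[of _ w] exI[of _ "[]"]) (auto intro: reversing_grid.left)
qed

text \<open>In a horizontal composition the cut runs through one of the two halves. In a vertical
  one the cut of the upper grid factors the middle word, and this factorisation dictates where the
  lower grid is cut.\<close>

lemma reversing_grid_hsplit:
  assumes "reversing_grid S R u v w t" "v = v\<^sub>1 @ v\<^sub>2"
  shows "\<exists>u\<^sub>1 w\<^sub>1 w\<^sub>2. reversing_grid S R u v\<^sub>1 w\<^sub>1 u\<^sub>1 \<and> reversing_grid S R u\<^sub>1 v\<^sub>2 w\<^sub>2 t \<and> w = w\<^sub>1 @ w\<^sub>2"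
  using assms
proof (induction arbitrary: v\<^sub>1 v\<^sub>2 rule: reversing_grid.induct)
  case (tile s t x y)
  have "reversing_grid S R [s] [t] x y" by (rule reversing_grid.tile) fact+
  moreover have "v\<^sub>1 = [] \<or> v\<^sub>2 = []" using tile.prems by (auto simp: Cons_eq_append_conv)
  ultimately show ?case using reversing_grid_split_trivial tile.prems by blast
next
  case (same s)
  have "reversing_grid S R [s] [s] [] []" by (rule reversing_grid.same) fact
  moreover have "v\<^sub>1 = [] \<or> v\<^sub>2 = []" using same.prems by (auto simp: Cons_eq_append_conv)
  ultimately show ?case using reversing_grid_split_trivial same.prems by blast
next
  case (top v)
  then show ?case
    by (intro exI[of _ "[]"] exI[of _ v\<^sub>1] exI[of _ v\<^sub>2]) (auto intro: reversing_grid.top)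
next
  case (left u)
  then show ?case by (auto intro!: exI[of _ u] intro: reversing_grid.left)
next
  case (hcomp u a w\<^sub>1 u\<^sub>1 b w\<^sub>2 u\<^sub>2)
  from hcomp.prems obtain us where "a = v\<^sub>1 @ us \<and> us @ b = v\<^sub>2 \<or> a @ us = v\<^sub>1 \<and> b = us @ v\<^sub>2"
    by (auto simp: append_eq_append_conv2)
  then show ?case
  proof
    assume *: "a = v\<^sub>1 @ us \<and> us @ b = v\<^sub>2"
    with hcomp.IH(1) obtain p q r where "reversing_grid S R u v\<^sub>1 q p"
      "reversing_grid S R p us r u\<^sub>1" "w\<^sub>1 = q @ r" by blast
    moreover from this have "reversing_grid S R p v\<^sub>2 (r @ w\<^sub>2) u\<^sub>2"
      using reversing_grid.hcomp hcomp.hyps(2) * by blast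
    ultimately show ?thesis using * by (metis append.assoc)
  next
    assume *: "a @ us = v\<^sub>1 \<and> b = us @ v\<^sub>2"
    with hcomp.IH(2) obtain p q r where "reversing_grid S R u\<^sub>1 us q p"
      "reversing_grid S R p v\<^sub>2 r u\<^sub>2" "w\<^sub>2 = q @ r" by blast
    moreover from this have "reversing_grid S R u v\<^sub>1 (w\<^sub>1 @ q) p"
      using reversing_grid.hcomp hcomp.hyps(1) * by blast
    ultimately show ?thesis using * by (metis append.assoc)
  qed
next
  case (vcomp a v w\<^sub>1 t\<^sub>1 b w\<^sub>2 t\<^sub>2)
  from vcomp.IH(1)[OF vcomp.prems] obtain p q r where 1: "reversing_grid S R a v\<^sub>1 q p"
    "reversing_grid S R p v\<^sub>2 r t\<^sub>1" "w\<^sub>1 = q @ r" by blast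
  from vcomp.IH(2)[OF 1(3)] obtain p' q' r' where "reversing_grid S R b q q' p'"
    "reversing_grid S R p' r r' t\<^sub>2" "w\<^sub>2 = q' @ r'" by blast
  with reversing_grid.vcomp[OF 1(1)] reversing_grid.vcomp[OF 1(2)] show ?case by blast
qed

lemma reversing_grid_vsplit:
  assumes "reversing_grid S R (u\<^sub>1 @ u\<^sub>2) v w t"
  shows "\<exists>w\<^sub>1 t\<^sub>1 t\<^sub>2. reversing_grid S R u\<^sub>1 v w\<^sub>1 t\<^sub>1 \<and> reversing_grid S R u\<^sub>2 w\<^sub>1 w t\<^sub>2 \<and> t = t\<^sub>1 @ t\<^sub>2"
proof -
  obtain w\<^sub>1 t\<^sub>1 t\<^sub>2 where "reversing_grid S R v u\<^sub>1 t\<^sub>1 w\<^sub>1"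
    "reversing_grid S R w\<^sub>1 u\<^sub>2 t\<^sub>2 w" "t = t\<^sub>1 @ t\<^sub>2"
    using reversing_grid_hsplit[OF reversing_grid_sym[OF assms] HOL.refl] by blast
  from this(1,2)[THEN reversing_grid_sym] this(3) show ?thesis by blast
qed

lemma reversing_grid_Nil_right:
  "reversing_grid S R u v w t \<Longrightarrow> v = [] \<Longrightarrow> w = [] \<and> t = u"
  by (induction rule: reversing_grid.induct) auto

lemma reversing_grid_Nil_left:
  "reversing_grid S R [] v w t \<Longrightarrow> w = v \<and> t = []"
  by (meson reversing_grid_Nil_right reversing_grid_sym)

text \<open>A composition with one-letter sides has an empty factor, whose grid is degenerate and
  passes its other side through unchanged; what remains is a single \<open>tile\<close> or
  \<open>same\<close>.\<close>

lemma reversing_grid_letters: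
  "reversing_grid S R u v w t \<Longrightarrow> u = [a] \<Longrightarrow> v = [b] \<Longrightarrow>
    Upair (a # w) (b # t) \<in> R \<or> (a = b \<and> w = [] \<and> t = [])"
proof (induction arbitrary: a b rule: reversing_grid.induct)
  case (hcomp u v\<^sub>1 w\<^sub>1 u\<^sub>1 v\<^sub>2 w\<^sub>2 u\<^sub>2)
  from hcomp.prems consider "v\<^sub>1 = []" "v\<^sub>2 = [b]" | "v\<^sub>1 = [b]" "v\<^sub>2 = []"
    by (metis append_eq_Cons_conv append_is_Nil_conv)
  then show ?case
  proof cases
    case 1
    then show ?thesis using reversing_grid_Nil_right[OF hcomp.hyps(1)] hcomp by auto
  next
    case 2
    then show ?thesis using reversing_grid_Nil_right[OF hcomp.hyps(2)] hcomp by auto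
  qed
next
  case (vcomp u\<^sub>1 v w\<^sub>1 t\<^sub>1 u\<^sub>2 w\<^sub>2 t\<^sub>2)
  from vcomp.prems consider "u\<^sub>1 = []" "u\<^sub>2 = [a]" | "u\<^sub>1 = [a]" "u\<^sub>2 = []"
    by (metis append_eq_Cons_conv append_is_Nil_conv)
  then show ?case
  proof cases
    case 1
    then show ?thesis using reversing_grid_Nil_left[of S R v w\<^sub>1 t\<^sub>1] vcomp by auto
  next
    case 2
    then show ?thesis using reversing_grid_Nil_left[of S R w\<^sub>1 w\<^sub>2 t\<^sub>2] vcomp by auto
  qed
qed auto

section \<open>Grids and right-reversing\<close>

lemma inv_word_simps [simp]:
  "inv_word [] = []" "inv_word (s # u) = inv_word u @ [Inr s]"
  "inv_word (u @ v) = inv_word v @ inv_word u"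
  by (simp_all add: inv_word_def)

lemma pos_word_simps [simp]:
  "pos_word [] = []" "pos_word (s # u) = Inl s # pos_word u"
  "pos_word (u @ v) = pos_word u @ pos_word v"
  by (simp_all add: pos_word_def)

lemma right_reverses_step_context:
  assumes "right_reverses_step S R w w'"
  shows "right_reverses_step S R (a @ w @ b) (a @ w' @ b)"
  using assms
proof cases
  case (relation s s' v v' x y)
  then show ?thesis
    using right_reverses_step.relation[of s S s' v v' R "a @ x" "y @ b"] by simp
next
  case (delete s x y)
  then show ?thesis
    using right_reverses_step.delete[of s S R "a @ x" "y @ b"] by simp
qed

lemma right_reverses_context:
  "right_reverses S R w w' \<Longrightarrow> right_reverses S R (a @ w @ b) (a @ w' @ b)"
  unfolding right_reverses_def
proof (induction rule: rtranclp_induct)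
  case (step v w')
  from step.IH right_reverses_step_context[OF step.hyps(2)] show ?case
    by (rule rtranclp.rtrancl_into_rtrancl)
qed simp

lemma right_reverses_trans:
  "right_reverses S R u v \<Longrightarrow> right_reverses S R v w \<Longrightarrow> right_reverses S R u w"
  unfolding right_reverses_def by (rule rtranclp_trans)

lemma reversing_grid_right_reverses:
  "reversing_grid S R u v w t \<Longrightarrow>
    right_reverses S R (inv_word u @ pos_word v) (pos_word w @ inv_word t)"
proof (induction rule: reversing_grid.induct)
  case (tile s t x y)
  then show ?case
    using right_reverses_step.relation[of s S t y x R "[]" "[]"]
    by (auto simp: right_reverses_def)
next
  case (same s)
  then show ?case
    using right_reverses_step.delete[of s S R "[]" "[]"]
    by (auto simp: right_reverses_def)
next
  case (hcomp u v\<^sub>1 w\<^sub>1 u\<^sub>1 v\<^sub>2 w\<^sub>2 u\<^sub>2)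
  from right_reverses_trans[OF right_reverses_context[OF hcomp.IH(1), of "[]" "pos_word v\<^sub>2"]]
    right_reverses_context[OF hcomp.IH(2), of "pos_word w\<^sub>1" "[]"]
  show ?case by simp
next
  case (vcomp u\<^sub>1 v w\<^sub>1 t\<^sub>1 u\<^sub>2 w\<^sub>2 t\<^sub>2)
  from right_reverses_trans[OF right_reverses_context[OF vcomp.IH(1), of "inv_word u\<^sub>2" "[]"]]
    right_reverses_context[OF vcomp.IH(2), of "[]" "inv_word t\<^sub>1"]
  show ?case by simp
qed (auto simp: right_reverses_def)

text \<open>\<open>reverses_to S R w p q\<close> evaluates an arbitrary signed word \<open>w\<close> to \<open>p q\<^sup>-\<^sup>1\<close> letter by letter
  from the right.  It is invariant under expansion of \<open>w\<close>, which turns a reversing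
  sequence, whose steps may come in any order, into a grid.\<close>

inductive reverses_to ::
  "'s set \<Rightarrow> 's list uprod set \<Rightarrow> 's signed_word \<Rightarrow> 's list \<Rightarrow> 's list \<Rightarrow> bool"
  for S :: "'s set" and R :: "'s list uprod set" where
  Nil: "reverses_to S R [] [] []"
| pos: "s \<in> S \<Longrightarrow> reverses_to S R w p q \<Longrightarrow> reverses_to S R (Inl s # w) (s # p) q"
| inv: "reverses_to S R w p q \<Longrightarrow> reversing_grid S R [s] p p' t \<Longrightarrow>
     reverses_to S R (Inr s # w) p' (q @ t)"

inductive_cases reverses_to_NilE: "reverses_to S R [] p q"
inductive_cases reverses_to_InlE: "reverses_to S R (Inl s # w) p q"
inductive_cases reverses_to_InrE: "reverses_to S R (Inr s # w) p q"

lemma reverses_to_lists: "reverses_to S R w p q \<Longrightarrow> p \<in> lists S"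
  by (induction rule: reverses_to.induct) (auto dest: reversing_grid_lists)

lemma reverses_to_pos_word:
  "reverses_to S R (pos_word v @ w) p q \<Longrightarrow> \<exists>p'. reverses_to S R w p' q \<and> p = v @ p'"
  by (induction v arbitrary: p) (auto elim!: reverses_to_InlE)

lemma reverses_to_inv_word:
  "reverses_to S R (inv_word u @ w) p q \<Longrightarrow>
    \<exists>p' q' t. reverses_to S R w p' q' \<and> reversing_grid S R u p' p t \<and> q = q' @ t"
proof (induction u arbitrary: w)
  case Nil
  then have "reverses_to S R w p q" "reversing_grid S R [] p p []"
    by (auto intro: reversing_grid.top dest: reverses_to_lists)
  then show ?case by auto
next
  case (Cons s u)
  then have "reverses_to S R (inv_word u @ Inr s # w) p q" by simp
  from Cons.IH[OF this] obtain p\<^sub>1 q\<^sub>1 t where 1: "reverses_to S R (Inr s # w) p\<^sub>1 q\<^sub>1"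
    "reversing_grid S R u p\<^sub>1 p t" "q = q\<^sub>1 @ t" by blast
  from 1(1) obtain p\<^sub>2 q\<^sub>2 t' where 2: "reverses_to S R w p\<^sub>2 q\<^sub>2"
    "reversing_grid S R [s] p\<^sub>2 p\<^sub>1 t'" "q\<^sub>1 = q\<^sub>2 @ t'" by (auto elim: reverses_to_InrE)
  from reversing_grid.vcomp[OF 2(2) 1(2)] 1(3) 2(1,3) show ?case by auto
qed

text \<open>Evaluation runs from right to left, so a suffix influences it only through its own
  values.\<close>

lemma reverses_to_context:
  assumes "\<And>p q. reverses_to S R w' p q \<Longrightarrow> reverses_to S R w p q"
  shows "reverses_to S R (x @ w') p q \<Longrightarrow> reverses_to S R (x @ w) p q"
proof (induction x arbitrary: p q)
  case (Cons a x)
  show ?case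
  proof (cases a)
    case (Inl s)
    with Cons.prems show ?thesis
      by (auto elim!: reverses_to_InlE intro!: reverses_to.pos dest: Cons.IH)
  next
    case (Inr s)
    with Cons.prems obtain p' q' t where 1: "reverses_to S R (x @ w') p' q'"
      "reversing_grid S R [s] p' p t" "q = q' @ t" by (auto elim: reverses_to_InrE)
    from reverses_to.inv[OF Cons.IH[OF 1(1)] 1(2)] 1(3) Inr show ?thesis by simp
  qed
qed (simp add: assms)

lemma reverses_to_step:
  assumes "right_reverses_step S R w w'" "reverses_to S R w' p q"
  shows "reverses_to S R w p q"
  using assms(1)
proof cases
  case (relation s s' v v' x y)
  have "reverses_to S R ([Inr s, Inl s'] @ y) p q"
    if w': "reverses_to S R (pos_word v' @ inv_word v @ y) p q" for p q
  proof -
    obtain p\<^sub>1 where 1: "reverses_to S R (inv_word v @ y) p\<^sub>1 q" "p = v' @ p\<^sub>1"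
      using reverses_to_pos_word[OF w'] by blast
    obtain p\<^sub>2 q\<^sub>2 t where 2: "reverses_to S R y p\<^sub>2 q\<^sub>2" "reversing_grid S R v p\<^sub>2 p\<^sub>1 t" "q = q\<^sub>2 @ t"
      using reverses_to_inv_word[OF 1(1)] by blast
    \<comment> \<open>The tile of the applied relation is glued to the left of the grid for
      \<open>v\<close>, so that \<open>s^-1 s' y\<close> evaluates to the same pair as
      \<open>v' v^-1 y\<close>.\<close>
    have "reversing_grid S R [s] [s'] v' v"
      using relation by (intro reversing_grid.tile) auto
    from reversing_grid.hcomp[OF this 2(2)] have "reversing_grid S R [s] (s' # p\<^sub>2) p t"
      using 1(2) by simp
    from reverses_to.inv[OF reverses_to.pos[OF _ 2(1)] this] 2(3) relation show ?thesis by simp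
  qed
  from reverses_to_context[OF this, where x = x and p = p and q = q] assms(2) relation show ?thesis by simp
next
  case (delete s x y)
  have "reverses_to S R ([Inr s, Inl s] @ y) p q" if w': "reverses_to S R y p q" for p q
  proof -
    have "reversing_grid S R ([s]) ([s] @ p) ([] @ p) []"
      by (rule reversing_grid.hcomp[OF reversing_grid.same[OF delete(3)]
            reversing_grid.top[OF reverses_to_lists[OF w']]])
    from reverses_to.inv[OF reverses_to.pos[OF delete(3) w'] this[unfolded append.simps]]
    show ?thesis by simp
  qed
  from reverses_to_context[OF this, where x = x and p = p and q = q] assms(2) delete show ?thesis by simp
qed

text \<open>The empty word evaluates to the empty pair, and this value is pulled back through the
  reversing sequence one step at a time, starting from its end.\<close>

lemma right_reverses_Nil_reversing_grid:
  assumes "right_reverses S R (inv_word u @ pos_word v) []"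
  shows "reversing_grid S R u v [] []"
proof -
  have "reverses_to S R w [] []" if "right_reverses S R w []" for w
    using that unfolding right_reverses_def
    by (induction rule: converse_rtranclp_induct) (auto intro: reverses_to.Nil reverses_to_step)
  from reverses_to_inv_word[OF this[OF assms]] obtain p where
    p: "reverses_to S R (pos_word v) p []" and g: "reversing_grid S R u p [] []" by auto
  from p reverses_to_pos_word[of S R v "[]"] have "p = v" by (auto elim: reverses_to_NilE)
  with g show ?thesis by simp
qed

section \<open>Reversing equivalence\<close>

abbreviation reversing_equiv :: "'s set \<Rightarrow> 's list uprod set \<Rightarrow> 's list \<Rightarrow> 's list \<Rightarrow> bool" where
  "reversing_equiv S R u v \<equiv> reversing_grid S R u v [] []"

lemma reversing_equiv_refl: "u \<in> lists S \<Longrightarrow> reversing_equiv S R u u"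
proof (induction u)
  case (Cons s u)
  then have "reversing_grid S R ([s] @ u) [s] [] ([] @ u)"
    using reversing_grid.vcomp[OF reversing_grid.same reversing_grid.left] by auto
  moreover have "reversing_equiv S R ([] @ u) u" using Cons by auto
  ultimately have "reversing_grid S R ([s] @ u) ([s] @ u) ([] @ []) []"
    by (rule reversing_grid.hcomp)
  then show ?case by simp
qed (auto intro: reversing_grid.top)

text \<open>Four cells in a two-by-two arrangement: upper left, lower left, upper right, lower
  right. All outer bottom and right sides are empty.\<close>

lemma reversing_equiv_append:
  assumes "reversing_grid S R u\<^sub>1 v\<^sub>1 x y" "reversing_grid S R u\<^sub>2 x [] a"
    "reversing_grid S R y v\<^sub>2 b []" "reversing_equiv S R a b"
  shows "reversing_equiv S R (u\<^sub>1 @ u\<^sub>2) (v\<^sub>1 @ v\<^sub>2)"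
proof -
  have "reversing_grid S R (u\<^sub>1 @ u\<^sub>2) v\<^sub>1 [] (y @ a)"
    using assms by (intro reversing_grid.vcomp)
  moreover have "reversing_grid S R (y @ a) v\<^sub>2 [] ([] @ [])"
    using assms by (intro reversing_grid.vcomp)
  ultimately have "reversing_grid S R (u\<^sub>1 @ u\<^sub>2) (v\<^sub>1 @ v\<^sub>2) ([] @ []) ([] @ [])"
    by (intro reversing_grid.hcomp) auto
  then show ?thesis by simp
qed

text \<open>Cutting along both factorisations gives four cells; those along the bottom and right
  border inherit empty outer sides.\<close>

lemma reversing_equiv_appendE:
  assumes "reversing_equiv S R (u\<^sub>1 @ u\<^sub>2) (v\<^sub>1 @ v\<^sub>2)"
  obtains x y a b where "reversing_grid S R u\<^sub>1 v\<^sub>1 x y" "reversing_grid S R u\<^sub>2 x [] a"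
    "reversing_grid S R y v\<^sub>2 b []" "reversing_equiv S R a b"
proof -
  obtain w where 1: "reversing_grid S R u\<^sub>1 (v\<^sub>1 @ v\<^sub>2) w []" "reversing_grid S R u\<^sub>2 w [] []"
    using reversing_grid_vsplit[OF assms] by auto
  obtain x y b where 2: "reversing_grid S R u\<^sub>1 v\<^sub>1 x y" "reversing_grid S R y v\<^sub>2 b []" "w = x @ b"
    using reversing_grid_hsplit[OF 1(1) HOL.refl] by auto
  obtain a where "reversing_grid S R u\<^sub>2 x [] a" "reversing_equiv S R a b"
    using reversing_grid_hsplit[OF 1(2) 2(3)] by auto
  with 2 that show thesis by blast
qed

lemma reversing_equiv_append_left:
  assumes "u \<in> lists S" "reversing_equiv S R v w"
  shows "reversing_equiv S R (u @ v) (u @ w)"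
  using assms reversing_grid_lists[OF assms(2)]
  by (auto intro: reversing_equiv_append[of S R u u "[]" "[]" v v w w]
      reversing_equiv_refl reversing_grid.left reversing_grid.top)

lemma reversing_equiv_append_right:
  assumes "reversing_equiv S R u v" "w \<in> lists S"
  shows "reversing_equiv S R (u @ w) (v @ w)"
  using assms
  by (auto intro: reversing_equiv_append[of S R u v "[]" "[]" w w w w]
      reversing_equiv_refl reversing_grid.left reversing_grid.top)

text \<open>The remaining right side \<open>a\<close> is closed off by placing \<open>a\<close>
  against itself.\<close>

lemma reversing_grid_imp_equiv:
  assumes "reversing_grid S R u v [] a"
  shows "reversing_equiv S R u (v @ a)"
  using reversing_grid.hcomp[OF assms reversing_equiv_refl] reversing_grid_lists[OF assms] by auto

section \<open>Presentations\<close>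

locale presentation =
  fixes S :: "'s set" and R :: "'s list uprod set"
  assumes presentation: "semigroup_presentation S R"
begin

abbreviation grid where "grid \<equiv> reversing_grid S R"
abbreviation revequiv (infix "\<sim>" 50) where "u \<sim> v \<equiv> reversing_equiv S R u v"
abbreviation wordcong (infix "\<approx>" 50) where "u \<approx> v \<equiv> (u, v) \<in> word_cong S R"

lemma relation_words:
  assumes "Upair v v' \<in> R"
  shows "v \<in> lists S - {[]}" "v' \<in> lists S - {[]}"
  using presentation assms unfolding semigroup_presentation_def by blast+

lemma word_cong_lists: "u \<approx> v \<Longrightarrow> u \<in> lists S \<and> v \<in> lists S"
  by (induction rule: word_cong.induct) (auto dest: relation_words)

text \<open>Holds because relations have nonempty sides; it permits giving \<open>[]\<close> weight
  0 whatever the weights of the other words are.\<close>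

lemma word_cong_Nil_iff: "u \<approx> v \<Longrightarrow> u = [] \<longleftrightarrow> v = []"
  by (induction rule: word_cong.induct) (auto dest: relation_words)

lemma equiv_word_cong: "equiv (lists S) (word_cong S R)"
proof (rule equivI)
  show "refl_on (lists S) (word_cong S R)"
    by (auto intro!: refl_onI word_cong.refl)
  show "Relation.sym (word_cong S R)" by (auto intro: symI word_cong.sym)
  show "Relation.trans (word_cong S R)" by (auto intro: transI word_cong.trans)
qed (use word_cong_lists in auto)

lemma word_class_eq_iff:
  "u \<in> lists S \<Longrightarrow> v \<in> lists S \<Longrightarrow> word_class S R u = word_class S R v \<longleftrightarrow> u \<approx> v"
  unfolding word_class_def by (rule eq_equiv_class_iff[OF equiv_word_cong])

lemma mult_word_class:
  assumes "u \<in> lists S" "v \<in> lists S"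
  shows "word_class S R u \<otimes>\<^bsub>presented_monoid S R\<^esub> word_class S R v = word_class S R (u @ v)"
proof -
  have "word_class S R (a @ b) = word_class S R (u @ v)"
    if "a \<in> word_class S R u" "b \<in> word_class S R v" for a b
  proof -
    have "u @ v \<approx> a @ b" using that by (auto simp: word_class_def intro: word_cong.mult)
    then show ?thesis using word_class_eq_iff word_cong_lists by metis
  qed
  moreover have "u \<in> word_class S R u" "v \<in> word_class S R v"
    using assms by (auto simp: word_class_def intro: word_cong.refl)
  ultimately show ?thesis
    unfolding presented_monoid_def monoid.simps by blast
qed

text \<open>The two boundary paths of a cell spell congruent words, and pasting cells preserves
  this, as for commuting squares.\<close>

lemma reversing_grid_word_cong: "grid u v w t \<Longrightarrow> u @ w \<approx> v @ t"
proof (induction rule: reversing_grid.induct)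
  case (tile s t x y)
  then show ?case by (auto intro: word_cong.rel)
next
  case (hcomp u v\<^sub>1 w\<^sub>1 u\<^sub>1 v\<^sub>2 w\<^sub>2 u\<^sub>2)
  have "(u @ w\<^sub>1) @ w\<^sub>2 \<approx> (v\<^sub>1 @ u\<^sub>1) @ w\<^sub>2"
    using hcomp reversing_grid_lists by (blast intro: word_cong.mult word_cong.refl)
  moreover have "v\<^sub>1 @ (u\<^sub>1 @ w\<^sub>2) \<approx> v\<^sub>1 @ (v\<^sub>2 @ u\<^sub>2)"
    using hcomp reversing_grid_lists by (blast intro: word_cong.mult word_cong.refl)
  ultimately show ?case by (auto intro: word_cong.trans)
next
  case (vcomp u\<^sub>1 v w\<^sub>1 t\<^sub>1 u\<^sub>2 w\<^sub>2 t\<^sub>2)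
  have "u\<^sub>1 @ (u\<^sub>2 @ w\<^sub>2) \<approx> u\<^sub>1 @ (w\<^sub>1 @ t\<^sub>2)"
    using vcomp reversing_grid_lists by (blast intro: word_cong.mult word_cong.refl)
  moreover have "(u\<^sub>1 @ w\<^sub>1) @ t\<^sub>2 \<approx> (v @ t\<^sub>1) @ t\<^sub>2"
    using vcomp reversing_grid_lists by (blast intro: word_cong.mult word_cong.refl)
  ultimately show ?case by (auto intro: word_cong.trans)
qed (auto intro: word_cong.refl)

lemma reversing_equiv_word_cong: "u \<sim> v \<Longrightarrow> u \<approx> v"
  using reversing_grid_word_cong[of u v "[]" "[]"] by simp

end

section \<open>Transitivity of reversing equivalence from the cube condition\<close>

locale weighted_cube_presentation = presentation S R
  for S :: "'s set" and R :: "'s list uprod set" +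
  fixes weight :: "'s list \<Rightarrow> nat"
  assumes weight_cong: "(u, v) \<in> word_cong S R \<Longrightarrow> weight u = weight v"
    and weight_append: "u \<in> lists S \<Longrightarrow> v \<in> lists S \<Longrightarrow> weight (u @ v) \<ge> weight u + weight v"
    and weight_letter: "s \<in> S \<Longrightarrow> weight [s] \<ge> 1"
    and weight_Nil: "weight [] = 0"
    and cube: "\<lbrakk>s \<in> S; s' \<in> S; s'' \<in> S\<rbrakk> \<Longrightarrow> right_cube_condition S R [s] [s'] [s'']"
begin

lemma weight_Cons: "s \<in> S \<Longrightarrow> u \<in> lists S \<Longrightarrow> weight u < weight (s # u)"
  using weight_append[of "[s]" u] weight_letter[of s] by auto

lemma weight_suffix_le: "u \<in> lists S \<Longrightarrow> v \<in> lists S \<Longrightarrow> weight v \<le> weight (u @ v)"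
  using weight_append[of u v] by auto

lemma weight_equiv: "u \<sim> v \<Longrightarrow> weight u = weight v"
  by (simp add: weight_cong reversing_equiv_word_cong)

lemma weight_eq_0: "u \<in> lists S \<Longrightarrow> weight u = 0 \<Longrightarrow> u = []"
  using weight_Cons by (cases u) force+

text \<open>The first two grids reverse \<open>s^-1 t t^-1 s'\<close> to
  \<open>x y^-1 y' x'^-1\<close>, and the third reverses this to \<open>(x c) (x' d)^-1\<close>: the
  premise of the cube condition for \<open>s\<close>, \<open>s'\<close>, \<open>t\<close>.\<close>

lemma cube_grid:
  assumes "grid [s] [t] x y" "grid [t] [s'] y' x'" "grid y y' c d"
  shows "s # x @ c \<sim> s' # x' @ d"
proof -
  have S: "s \<in> S" "t \<in> S" "s' \<in> S" and cd: "x @ c \<in> lists S" "x' @ d \<in> lists S"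
    using assms[THEN reversing_grid_lists] by auto
  have "right_reverses S R (inv_word [s] @ pos_word [t] @ inv_word [t] @ pos_word [s'])
      (pos_word x @ inv_word y @ inv_word [t] @ pos_word [s'])"
    using right_reverses_context[OF reversing_grid_right_reverses[OF assms(1)],
        of "[]" "inv_word [t] @ pos_word [s']"] by simp
  moreover have "right_reverses S R (pos_word x @ inv_word y @ inv_word [t] @ pos_word [s'])
      (pos_word x @ inv_word y @ pos_word y' @ inv_word x')"
    using right_reverses_context[OF reversing_grid_right_reverses[OF assms(2)],
        of "pos_word x @ inv_word y" "[]"] by simp
  moreover have "right_reverses S R (pos_word x @ inv_word y @ pos_word y' @ inv_word x')
      (pos_word (x @ c) @ inv_word (x' @ d))"
    using right_reverses_context[OF reversing_grid_right_reverses[OF assms(3)],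
        of "pos_word x" "inv_word x'"] by simp
  ultimately have "right_reverses S R
      (inv_word [s] @ pos_word [t] @ inv_word [t] @ pos_word [s'])
      (pos_word (x @ c) @ inv_word (x' @ d))"
    by (meson right_reverses_trans)
  with cube[OF S(1,3,2)] cd
  have "right_reverses S R (inv_word ([s] @ x @ c) @ pos_word ([s'] @ x' @ d)) []"
    unfolding right_cube_condition_def by blast
  from right_reverses_Nil_reversing_grid[OF this] show ?thesis by simp
qed

text \<open>The weight of the middle word \<open>s # u'\<close> may be exactly \<open>n\<close>, out
  of reach of \<open>IH\<close>. But in the grid for \<open>s # u'\<close> and \<open>v\<close>, cut
  after the first letters, \<open>u'\<close> borders a single cell; transitivity is then needed only
  at \<open>u'\<close> and at \<open>a\<close>, which is no heavier.\<close>

lemma reversing_equiv_trans_same_head: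
  assumes IH: "\<And>u v w. weight v < n \<Longrightarrow> u \<sim> v \<Longrightarrow> v \<sim> w \<Longrightarrow> u \<sim> w"
    and n: "weight (s # u') \<le> n" and uu': "u \<sim> u'" and v: "s # u' \<sim> v"
  shows "s # u \<sim> v"
proof -
  have S: "s \<in> S" "u \<in> lists S" "u' \<in> lists S" "v \<in> lists S"
    using uu' v by (auto dest: reversing_grid_lists)
  have "v \<noteq> []"
    using weight_equiv[OF v] weight_Cons[OF S(1,3)] weight_Nil by auto
  then obtain r v' where v_eq: "v = [r] @ v'" by (cases v) auto
  have n': "weight u' < n" using n weight_Cons[OF S(1,3)] by simp
  have "[s] @ u' \<sim> [r] @ v'" using v v_eq by simp
  then obtain x y a b where 1: "grid [s] [r] x y" "grid u' x [] a" "grid y v' b []" "a \<sim> b"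
    by (rule reversing_equiv_appendE)
  have xa: "u' \<sim> x @ a" by (rule reversing_grid_imp_equiv[OF 1(2)])
  have "weight (x @ a) < n" using n' weight_equiv[OF xa] by simp
  moreover have "weight a \<le> weight (x @ a)"
    using reversing_grid_lists[OF 1(2)] by (auto intro: weight_suffix_le)
  ultimately have na: "weight a < n" by simp
  \<comment> \<open>The lower left cell gets left side \<open>u\<close> in place of
    \<open>u'\<close>; its new right side \<open>q\<close> is equivalent to \<open>a\<close>, hence
    to \<open>b\<close>, so the corner still closes.\<close>
  have "u \<sim> x @ a" using IH[OF n' uu' xa] .
  from reversing_grid_hsplit[OF this HOL.refl] obtain q where q: "grid u x [] q" "q \<sim> a" by auto
  have "q \<sim> b" using IH[OF na q(2) 1(4)] .
  from reversing_equiv_append[OF 1(1) q(1) 1(3) this] show ?thesis using v_eq by simp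
qed

text \<open>The bound on the middle word also bounds the outer ones, since equivalent words are
  congruent and so have equal weight; the tails after the first letters are strictly
  lighter.\<close>

lemma reversing_equiv_trans_below:
  "weight v < n \<Longrightarrow> u \<sim> v \<Longrightarrow> v \<sim> w \<Longrightarrow> u \<sim> w"
proof (induction n arbitrary: u v w)
  case (Suc n)
  note IH = Suc.IH
  have S: "u \<in> lists S" "v \<in> lists S" "w \<in> lists S"
    using Suc.prems by (auto dest: reversing_grid_lists)
  have weights: "weight u = weight v" "weight w = weight v"
    using Suc.prems weight_equiv by metis+
  show ?case
  proof (cases "weight v = 0")
    case True
    then have "u = []" "v = []" using weight_eq_0 S weights by auto
    with Suc.prems show ?thesis by simp
  next
    case False
    then obtain s u\<^sub>1 t v\<^sub>1 s' w\<^sub>1 where eqs: "u = [s] @ u\<^sub>1" "v = [t] @ v\<^sub>1" "w = [s'] @ w\<^sub>1"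
      using weights weight_Nil
      by (metis append_Cons append_Nil neq_Nil_conv)
    have S': "s \<in> S" "u\<^sub>1 \<in> lists S" "t \<in> S" "v\<^sub>1 \<in> lists S" "s' \<in> S" "w\<^sub>1 \<in> lists S"
      using S eqs by auto
    have small: "weight u\<^sub>1 < n" "weight v\<^sub>1 < n" "weight w\<^sub>1 < n"
      using weight_Cons[OF S'(1,2)] weight_Cons[OF S'(3,4)] weight_Cons[OF S'(5,6)]
        weights eqs Suc.prems(1) by auto
    obtain x y a b where 1: "grid [s] [t] x y" "grid u\<^sub>1 x [] a" "grid y v\<^sub>1 b []" "a \<sim> b"
      using Suc.prems(2) unfolding eqs by (rule reversing_equiv_appendE)
    obtain y' x' b' a' where 2: "grid [t] [s'] y' x'" "grid v\<^sub>1 y' [] b'" "grid x' w\<^sub>1 a' []" "b' \<sim> a'"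
      using Suc.prems(3) unfolding eqs by (rule reversing_equiv_appendE)
    have v1: "y @ b \<sim> v\<^sub>1" "v\<^sub>1 \<sim> y' @ b'"
      using reversing_grid_sym[OF reversing_grid_imp_equiv[OF reversing_grid_sym[OF 1(3)]]]
        reversing_grid_imp_equiv[OF 2(2)] .
    \<comment> \<open>Transitivity at the tail \<open>v\<^sub>1\<close> of the middle word; cutting
      the resulting grid after \<open>y\<close> and \<open>y'\<close> yields the third face needed
      for \<open>cube_grid\<close>.\<close>
    have "y @ b \<sim> y' @ b'" using IH[OF small(2) v1] .
    then obtain c d e e' where 3: "grid y y' c d" "grid b c [] e" "grid d b' e' []" "e \<sim> e'"
      by (rule reversing_equiv_appendE)
    have ce: "b \<sim> c @ e" by (rule reversing_grid_imp_equiv[OF 3(2)])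
    have de': "d @ e' \<sim> b'"
      using reversing_grid_imp_equiv[OF reversing_grid_sym[OF 3(3)]] by (rule reversing_grid_sym)
    have L: "x \<in> lists S" "y \<in> lists S" "a \<in> lists S" "b \<in> lists S" "x' \<in> lists S" "y' \<in> lists S"
      "a' \<in> lists S" "b' \<in> lists S" "c \<in> lists S" "d \<in> lists S" "e \<in> lists S" "e' \<in> lists S"
      using 1 2 3 by (auto dest: reversing_grid_lists)
    have xa: "u\<^sub>1 \<sim> x @ a" by (rule reversing_grid_imp_equiv[OF 1(2)])
    have xa': "x' @ a' \<sim> w\<^sub>1"
      using reversing_grid_imp_equiv[OF reversing_grid_sym[OF 2(3)]] by (rule reversing_grid_sym)
    have wb: "weight b < n" and wb': "weight b' < n"
      using weight_suffix_le[OF L(2,4)] weight_suffix_le[OF L(6,8)] small(2)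
        weight_equiv[OF v1(1)] weight_equiv[OF v1(2)] by auto
    \<comment> \<open>The words \<open>e\<close> and \<open>e'\<close> may differ; replacing
      \<open>e'\<close> by \<open>e\<close> lets one common tail be appended to both sides of the
      cube.\<close>
    have de: "d @ e \<sim> b'"
    proof (rule IH[OF _ _ de'])
      show "weight (d @ e') < n" using wb' weight_equiv[OF de'] by simp
      show "d @ e \<sim> d @ e'" using reversing_equiv_append_left[OF L(10) 3(4)] .
    qed
    have "a \<sim> c @ e" using IH[OF wb 1(4) ce] .
    then have "x @ a \<sim> x @ c @ e" by (rule reversing_equiv_append_left[OF L(1)])
    moreover have "weight (x @ a) < n" using weight_equiv[OF xa] small by simp
    ultimately have u1: "u\<^sub>1 \<sim> x @ c @ e" using IH xa by blast
    have "d @ e \<sim> a'" using IH[OF wb' de 2(4)] .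
    then have "x' @ d @ e \<sim> x' @ a'" by (rule reversing_equiv_append_left[OF L(5)])
    moreover have "weight (x' @ a') < n" using weight_equiv[OF xa'] small by simp
    ultimately have w1: "x' @ d @ e \<sim> w\<^sub>1" using IH xa' by blast
    have mid: "s # x @ c @ e \<sim> s' # x' @ d @ e"
      using reversing_equiv_append_right[OF cube_grid[OF 1(1) 2(1) 3(1)] L(11)] by simp
    have "u \<sim> s # x @ c @ e" using reversing_equiv_append_left[of "[s]" S R, OF _ u1] S' eqs by simp
    then have wm: "weight (s # x @ c @ e) \<le> n"
      using weight_equiv weights Suc.prems(1) by fastforce
    \<comment> \<open>The weight of the middle words may be exactly \<open>n\<close>, so the
      induction hypothesis does not join \<open>u\<close>, \<open>mid\<close> and \<open>w\<close>.
      The shared head is used instead: \<open>s\<close> on the side of \<open>u\<close> and, with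
      the directions reversed, \<open>s'\<close> on the side of \<open>w\<close>.\<close>
    have um: "u \<sim> s' # x' @ d @ e"
      using reversing_equiv_trans_same_head[OF IH wm u1 mid] eqs by simp
    have "weight (s' # x' @ d @ e) \<le> n"
      using wm weight_equiv[OF mid] by simp
    moreover have "w\<^sub>1 \<sim> x' @ d @ e" using reversing_grid_sym[OF w1] .
    ultimately have "w \<sim> u"
      using reversing_equiv_trans_same_head[OF IH _ _ reversing_grid_sym[OF um]] eqs by simp
    then show ?thesis by (rule reversing_grid_sym)
  qed
qed simp

lemma reversing_equiv_trans: "u \<sim> v \<Longrightarrow> v \<sim> w \<Longrightarrow> u \<sim> w"
  by (rule reversing_equiv_trans_below[OF lessI])

text \<open>Reversing equivalence is itself a congruence containing \<open>R\<close>. The weight and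
  the cube condition enter only through its transitivity.\<close>

lemma word_cong_reversing_equiv: "u \<approx> v \<Longrightarrow> u \<sim> v"
proof (induction rule: word_cong.induct)
  case (rel v v')
  then obtain s x t y where eqs: "v = [s] @ x" "v' = [t] @ y" "s \<in> S" "t \<in> S" "x \<in> lists S" "y \<in> lists S"
    using relation_words[OF rel] by (cases v; cases v') auto
  then have "grid [s] [t] x y" using rel by (intro reversing_grid.tile) auto
  moreover have "grid x x [] []" "grid y y [] []"
    using eqs by (auto intro: reversing_equiv_refl)
  ultimately have "[s] @ x \<sim> [t] @ y"
    by (meson lists.Nil reversing_equiv_append reversing_grid.top)
  with eqs show ?case by simp
next
  case (mult u u' v v')
  have "u @ v \<sim> u @ v'" "u @ v' \<sim> u' @ v'"
    using reversing_equiv_append_left[OF _ mult.IH(2)] reversing_equiv_append_right[OF mult.IH(1)]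
      word_cong_lists mult.hyps by blast+
  then show ?case by (rule reversing_equiv_trans)
qed (auto intro: reversing_equiv_refl reversing_equiv_trans dest: reversing_grid_sym)

section \<open>Left-cancellation on words\<close>

text \<open>The first cell of the grid has \<open>s\<close> on both its left and top sides, so it is
  trivial or comes from a relation \<open>s x = s y\<close>; either way \<open>x = y\<close>. The
  other cells then give \<open>u\<close>, \<open>x @ a\<close>, \<open>x @ b\<close>,
  \<open>v\<close> as a chain of congruent words.\<close>

lemma left_cancel_letter:
  assumes no_rel: "\<And>v v'. v \<in> lists S \<Longrightarrow> v' \<in> lists S \<Longrightarrow> Upair (s # v) (s # v') \<in> R \<Longrightarrow> v = v'"
    and "s # u \<approx> s # v"
  shows "u \<approx> v"
proof -
  have "[s] @ u \<sim> [s] @ v" using word_cong_reversing_equiv assms(2) by simp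
  then obtain x y a b where 1: "grid [s] [s] x y" "grid u x [] a" "grid y v b []" "a \<sim> b"
    by (rule reversing_equiv_appendE)
  have "x = y"
    using reversing_grid_letters[OF 1(1)] no_rel reversing_grid_lists[OF 1(1)] by auto
  then have "u \<approx> x @ a" "x @ b \<approx> v"
    using reversing_grid_word_cong[OF 1(2)] reversing_grid_word_cong[OF 1(3)] by auto
  moreover have "x @ a \<approx> x @ b"
    using reversing_grid_lists[OF 1(1)] reversing_equiv_word_cong[OF 1(4)]
    by (auto intro: word_cong.mult word_cong.refl)
  ultimately show ?thesis by (meson word_cong.trans)
qed

lemma left_cancel:
  assumes "\<And>s v v'. s \<in> S \<Longrightarrow> v \<in> lists S \<Longrightarrow> v' \<in> lists S \<Longrightarrow> Upair (s # v) (s # v') \<in> R \<Longrightarrow> v = v'"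
  shows "w \<in> lists S \<Longrightarrow> w @ u \<approx> w @ v \<Longrightarrow> u \<approx> v"
proof (induction w)
  case (Cons s w)
  then have "s \<in> S" "w \<in> lists S" "s # w @ u \<approx> s # w @ v" by auto
  with left_cancel_letter[of s "w @ u" "w @ v"] assms Cons.IH show ?case by blast
qed simp

end


section \<open>Transfer from words to the semigroup or monoid\<close>

theorem theorem1:
  fixes M :: "('m, 'k) monoid_scheme"
    and S :: "'s set" and R :: "'s list uprod set"
    and \<phi> :: "'s list set \<Rightarrow> 'm"
  assumes "semigroup_presentation S R"
    and "(is_semigroup M \<and> \<phi> \<in> iso (presented_semigroup S R) M) \<or>
         (monoid M \<and> \<phi> \<in> iso (presented_monoid S R) M)"
    and "\<not> (\<exists>s\<in>S. \<exists>v\<in>lists S. \<exists>v'\<in>lists S. v \<noteq> v' \<and> Upair (s # v) (s # v') \<in> R)"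
    and "\<exists>len :: 'm \<Rightarrow> nat.
           (\<forall>x\<in>carrier M. \<forall>y\<in>carrier M. len (x \<otimes>\<^bsub>M\<^esub> y) \<ge> len x + len y) \<and>
           (\<forall>s\<in>S. len (\<phi> (word_class S R [s])) \<ge> 1)"
    and "\<forall>s\<in>S. \<forall>s'\<in>S. \<forall>s''\<in>S. right_cube_condition S R [s] [s'] [s'']"
  shows "\<forall>x\<in>carrier M. \<forall>y\<in>carrier M. \<forall>z\<in>carrier M.
           x \<otimes>\<^bsub>M\<^esub> y = x \<otimes>\<^bsub>M\<^esub> z \<longrightarrow> y = z"
proof -
  interpret presentation S R using assms(1) by unfold_locales
  \<comment> \<open>The words whose classes are mapped onto the carrier of \<open>M\<close>, so that
    the semigroup and monoid cases share one argument; if both alternatives hold, the semigroup one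
    is chosen.\<close>
  define W where "W = (if is_semigroup M \<and> \<phi> \<in> iso (presented_semigroup S R) M
    then lists S - {[]} else lists S)"
  define P where "P = (presented_monoid S R)\<lparr>carrier := W // word_cong S R\<rparr>"
  have P: "\<phi> \<in> iso P M"
    using assms(2) unfolding P_def W_def presented_semigroup_def
    by (auto simp: presented_monoid_def)
  have W: "W \<subseteq> lists S" "lists S - {[]} \<subseteq> W" by (auto simp: W_def)
  have W_append: "u @ v \<in> W" if "u \<in> W" "v \<in> W" for u v
    using that by (auto simp: W_def split: if_splits)
  have carrier_P: "carrier P = word_class S R ` W"
    by (auto simp: P_def quotient_def word_class_def)
  have bij: "bij_betw \<phi> (carrier P) (carrier M)" using P by (simp add: iso_def)
  have carrier_M: "carrier M = (\<lambda>w. \<phi> (word_class S R w)) ` W"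
    using bij carrier_P by (auto simp: bij_betw_def)
  have mult: "\<phi> (word_class S R u) \<otimes>\<^bsub>M\<^esub> \<phi> (word_class S R v) = \<phi> (word_class S R (u @ v))"
    if "u \<in> W" "v \<in> W" for u v
  proof -
    have "\<phi> (word_class S R u \<otimes>\<^bsub>P\<^esub> word_class S R v)
        = \<phi> (word_class S R u) \<otimes>\<^bsub>M\<^esub> \<phi> (word_class S R v)"
      using P that carrier_P by (auto simp: iso_def hom_def)
    moreover have "word_class S R u \<otimes>\<^bsub>P\<^esub> word_class S R v = word_class S R (u @ v)"
      using mult_word_class[of u v] that W(1) by (auto simp: P_def)
    ultimately show ?thesis by simp
  qed
  have inj: "\<phi> (word_class S R u) = \<phi> (word_class S R v) \<longleftrightarrow> u \<approx> v"
    if "u \<in> W" "v \<in> W" for u v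
  proof -
    have "\<phi> (word_class S R u) = \<phi> (word_class S R v) \<longleftrightarrow> word_class S R u = word_class S R v"
      using bij carrier_P that by (auto simp: bij_betw_def dest: inj_onD)
    then show ?thesis using word_class_eq_iff that W(1) by blast
  qed
  obtain len :: "'m \<Rightarrow> nat" where
    len: "\<And>x y. x \<in> carrier M \<Longrightarrow> y \<in> carrier M \<Longrightarrow> len (x \<otimes>\<^bsub>M\<^esub> y) \<ge> len x + len y"
    and len_letter: "\<And>s. s \<in> S \<Longrightarrow> len (\<phi> (word_class S R [s])) \<ge> 1"
    using assms(4) by blast
  \<comment> \<open>In the semigroup case the class of the empty word lies outside the carrier, where \<open>\<phi>\<close> and
    \<open>len\<close> are unconstrained.\<close>
  define weight where "weight w = (if w = [] then 0 else len (\<phi> (word_class S R w)))" for w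
  interpret weighted_cube_presentation S R weight
  proof
    fix u v assume uv: "u \<approx> v"
    show "weight u = weight v"
    proof (cases "u = []")
      case False
      then have "u \<in> W" "v \<in> W" using word_cong_lists[OF uv] word_cong_Nil_iff[OF uv] W(2) by auto
      with inj uv have "\<phi> (word_class S R u) = \<phi> (word_class S R v)" by blast
      with False word_cong_Nil_iff[OF uv] show ?thesis by (simp add: weight_def)
    qed (use word_cong_Nil_iff[OF uv] in \<open>simp add: weight_def\<close>)
  next
    fix u v assume uv: "u \<in> lists S" "v \<in> lists S"
    show "weight (u @ v) \<ge> weight u + weight v"
    proof (cases "u = [] \<or> v = []")
      case False
      then have "u \<in> W" "v \<in> W" using uv W(2) by auto
      with mult[of u v] len[of "\<phi> (word_class S R u)" "\<phi> (word_class S R v)"] carrier_M False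
      show ?thesis by (auto simp: weight_def)
    qed (auto simp: weight_def)
  qed (use assms(5) len_letter in \<open>auto simp: weight_def\<close>)
  show ?thesis
  proof (intro ballI impI)
    fix x y z
    assume "x \<in> carrier M" "y \<in> carrier M" "z \<in> carrier M" and eq: "x \<otimes>\<^bsub>M\<^esub> y = x \<otimes>\<^bsub>M\<^esub> z"
    then obtain a b c where abc: "a \<in> W" "b \<in> W" "c \<in> W" "x = \<phi> (word_class S R a)"
      "y = \<phi> (word_class S R b)" "z = \<phi> (word_class S R c)"
      unfolding carrier_M by blast
    have "a @ b \<approx> a @ c"
      using eq abc mult inj W_append by metis
    then have "b \<approx> c"
      using left_cancel[of a b c] assms(3) abc(1) W(1) by blast
    with abc inj show "y = z" by metis
  qed
qed

end
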